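(* Let $n\ge 2$ and let $E(\mathcal{SS}'_n)$ denote the set of idempotents of $\mathcal{SS}'_n$. Then $$|E(\mathcal{SS}'_n)|=\frac{3^{n-1}+1}{2}.$$
   Context: Let $[n]=\{1,2,\dots,n\}$ with its usual order. $\mathcal{P}_n$ is the semigroup of all partial transformations of $[n]$ (maps whose domain and image are subsets of $[n]$, including the empty map), composed from left to right: $x(\alpha\beta)=(x\alpha)\beta$. A partial map $\alpha$ is isotone if $x\le y$ implies $x\alpha\le y\alpha$ for all $x,y\in\mathrm{Dom}\,\alpha$, and order-decreasing if $x\alpha\le x$ for all $x\in\mathrm{Dom}\,\alpha$. $\mathcal{LS}_n$ is the monoid of all isotone order-decreasing $\alpha\in\mathcal{P}_n$, and $\mathcal{SS}'_n=\{\alpha\in\mathcal{LS}_n: 1\notin \mathrm{Dom}\,\alpha\}$, a subsemigroup of $\mathcal{LS}_n$. *)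

theory Defs
  imports Complex_Main
begin

definition PT :: "nat \<Rightarrow> (nat \<rightharpoonup> nat) set" where
  "PT n = {\<alpha>. dom \<alpha> \<subseteq> {1..n} \<and> ran \<alpha> \<subseteq> {1..n}}"

(* Left-to-right composition x(\<alpha>\<beta>) = (x\<alpha>)\<beta>; the library's map_comp is right-to-left. *)
definition pt_mult :: "(nat \<rightharpoonup> nat) \<Rightarrow> (nat \<rightharpoonup> nat) \<Rightarrow> (nat \<rightharpoonup> nat)" where
  "pt_mult \<alpha> \<beta> = \<beta> \<circ>\<^sub>m \<alpha>"

definition isotone :: "(nat \<rightharpoonup> nat) \<Rightarrow> bool" where
  "isotone \<alpha> \<longleftrightarrow> mono_on (dom \<alpha>) (\<lambda>x. the (\<alpha> x))"

definition order_decreasing :: "(nat \<rightharpoonup> nat) \<Rightarrow> bool" where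
  "order_decreasing \<alpha> \<longleftrightarrow> (\<forall>x\<in>dom \<alpha>. the (\<alpha> x) \<le> x)"

definition LS :: "nat \<Rightarrow> (nat \<rightharpoonup> nat) set" where
  "LS n = {\<alpha> \<in> PT n. isotone \<alpha> \<and> order_decreasing \<alpha>}"

definition SS' :: "nat \<Rightarrow> (nat \<rightharpoonup> nat) set" where
  "SS' n = {\<alpha> \<in> LS n. 1 \<notin> dom \<alpha>}"

definition idempotents :: "(nat \<rightharpoonup> nat) set \<Rightarrow> (nat \<rightharpoonup> nat) set" where
  "idempotents S = {\<epsilon> \<in> S. pt_mult \<epsilon> \<epsilon> = \<epsilon>}"

end

(* Every point of the domain of an idempotent in SS' is mapped to the largest fixed point not above
   it.  So an idempotent over n + 1 restricts to one over n, and an idempotent over n extends in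
   three ways: n + 1 is left out of the domain, is fixed, or (unless the idempotent is empty) is
   mapped to the maximum of the image.  Thus e (n + 1) = 3 * e n - 1 with e 1 = 1. *)

theory Submission
  imports Defs
begin

text \<open>For a partial map, idempotence says exactly that every image point is a fixed point. The
  pointwise form with \<open>Some\<close> avoids reasoning about \<open>the\<close> and composition
  later.\<close>

lemma idempotents_SS'_iff:
  "\<alpha> \<in> idempotents (SS' n) \<longleftrightarrow>
    dom \<alpha> \<subseteq> {2..n} \<and>
    (\<forall>x y. \<alpha> x = Some y \<longrightarrow> y \<le> x \<and> \<alpha> y = Some y) \<and>
    (\<forall>x y u v. \<alpha> x = Some u \<longrightarrow> \<alpha> y = Some v \<longrightarrow> x \<le> y \<longrightarrow> u \<le> v)"
  (is "?L \<longleftrightarrow> ?dom \<and> ?fix \<and> ?mono")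
proof
  assume L: ?L
  then have d: "dom \<alpha> \<subseteq> {1..n}" "1 \<notin> dom \<alpha>" and m: "isotone \<alpha>"
    and dec: "order_decreasing \<alpha>" and idem: "pt_mult \<alpha> \<alpha> = \<alpha>"
    by (auto simp: idempotents_def SS'_def LS_def PT_def)
  have "x \<in> {2..n}" if "x \<in> dom \<alpha>" for x
  proof -
    have "x \<in> {1..n}" "x \<noteq> 1" using d that by (blast, metis)
    then show ?thesis by simp
  qed
  then have ?dom by blast
  moreover have "y \<le> x \<and> \<alpha> y = Some y" if "\<alpha> x = Some y" for x y
  proof -
    have "(\<alpha> \<circ>\<^sub>m \<alpha>) x = \<alpha> x" using idem by (simp add: pt_mult_def)
    then have "\<alpha> y = Some y" using that by simp
    moreover have "y \<le> x" using bspec[OF dec[unfolded order_decreasing_def], of x] that by (simp add: domI)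
    ultimately show ?thesis by simp
  qed
  moreover have ?mono
    using m by (fastforce simp: isotone_def mono_on_def)
  ultimately show "?dom \<and> ?fix \<and> ?mono" by blast
next
  assume R: "?dom \<and> ?fix \<and> ?mono"
  \<comment> \<open>Image points are fixed, hence lie in the domain, so the bound on the image
    required by \<open>PT\<close> comes for free.\<close>
  have "ran \<alpha> \<subseteq> dom \<alpha>" using R by (auto simp: ran_def)
  then have "\<alpha> \<in> PT n" "1 \<notin> dom \<alpha>" using R by (force simp: PT_def)+
  moreover have "isotone \<alpha>" using R by (auto simp: isotone_def mono_on_def)
  moreover have "order_decreasing \<alpha>" using R by (auto simp: order_decreasing_def)
  moreover have "pt_mult \<alpha> \<alpha> = \<alpha>"
    using R by (auto simp: pt_mult_def map_comp_def fun_eq_iff split: option.split)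
  ultimately show ?L by (simp add: idempotents_def SS'_def LS_def)
qed

lemma ran_idempotents_SS':
  assumes "\<alpha> \<in> idempotents (SS' n)"
  shows "ran \<alpha> \<subseteq> {2..n}" and "finite (ran \<alpha>)"
    and "\<alpha> \<noteq> Map.empty \<Longrightarrow> Max (ran \<alpha>) \<in> ran \<alpha>"
proof -
  have "ran \<alpha> \<subseteq> dom \<alpha>" "dom \<alpha> \<subseteq> {2..n}"
    using assms unfolding idempotents_SS'_iff ran_def by blast+
  then show sub: "ran \<alpha> \<subseteq> {2..n}" by blast
  then show fin: "finite (ran \<alpha>)" by (rule finite_subset) simp
  assume "\<alpha> \<noteq> Map.empty"
  then have "ran \<alpha> \<noteq> {}" by (auto simp: ran_def fun_eq_iff)
  with fin show "Max (ran \<alpha>) \<in> ran \<alpha>" by (rule Max_in)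
qed

lemma idempotents_SS'_1: "idempotents (SS' (Suc 0)) = {Map.empty}"
  by (auto simp: idempotents_SS'_iff)

text \<open>Serves both kinds of proper extension. Assumption \<open>m\<close> speaks of the updated
  map so that it covers m = n + 1, fixed by the update itself, as well as a fixed point m of
  \<alpha>. Assumption \<open>max\<close> keeps the map isotone at the new top point.\<close>

lemma idempotents_SS'_upd:
  assumes \<alpha>: "\<alpha> \<in> idempotents (SS' n)" and "n \<ge> 1"
    and m: "(\<alpha>(Suc n \<mapsto> m)) m = Some m"
    and max: "\<And>v. v \<in> ran \<alpha> \<Longrightarrow> v \<le> m"
  shows "\<alpha>(Suc n \<mapsto> m) \<in> idempotents (SS' (Suc n))"
proof -
  let ?\<beta> = "\<alpha>(Suc n \<mapsto> m)"
  have dom: "dom \<alpha> \<subseteq> {2..n}"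
    and idem: "\<And>x y. \<alpha> x = Some y \<Longrightarrow> y \<le> x \<and> \<alpha> y = Some y"
    and mono: "\<And>x y u v. \<alpha> x = Some u \<Longrightarrow> \<alpha> y = Some v \<Longrightarrow> x \<le> y \<Longrightarrow> u \<le> v"
    using \<alpha> unfolding idempotents_SS'_iff by blast+
  have le: "x \<le> n" if "\<alpha> x = Some y" for x y
    using domI[of \<alpha> x y] dom that by auto
  have "dom ?\<beta> \<subseteq> {2..Suc n}" using dom \<open>n \<ge> 1\<close> by auto
  moreover have "y \<le> x \<and> ?\<beta> y = Some y" if "?\<beta> x = Some y" for x y
  proof (cases "x = Suc n")
    case True
    then have "y = m" using that by simp
    \<comment> \<open>If m differs from n + 1, then m is fixed by \<alpha> itself and so lies in its
      domain.\<close>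
    moreover have "m \<le> Suc n" using m le[of m m] by (cases "m = Suc n") auto
    ultimately show ?thesis using True m by simp
  next
    case False
    then have "y \<le> x \<and> \<alpha> y = Some y" using that idem[of x y] by simp
    moreover from this have "y \<le> n" using le[of y y] by simp
    ultimately show ?thesis by simp
  qed
  moreover have "u \<le> v" if "?\<beta> x = Some u" "?\<beta> y = Some v" "x \<le> y" for x y u v
  proof (cases "y = Suc n")
    case True
    then have "v = m" using that by simp
    then show ?thesis using max[of u] that(1) ranI[of \<alpha> x u] by (cases "x = Suc n") auto
  next
    case False
    then have "\<alpha> y = Some v" using that by simp
    moreover from this have "x \<noteq> Suc n" using le[of y v] that(3) by auto
    ultimately show ?thesis using mono[of x u y v] that by simp
  qed
  ultimately show ?thesis unfolding idempotents_SS'_iff by blast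
qed

lemma idempotents_SS'_Suc:
  assumes "n \<ge> 1"
  shows "idempotents (SS' (Suc n)) =
    idempotents (SS' n) \<union>
    (\<lambda>\<alpha>. \<alpha>(Suc n \<mapsto> Suc n)) ` idempotents (SS' n) \<union>
    (\<lambda>\<alpha>. \<alpha>(Suc n \<mapsto> Max (ran \<alpha>))) ` (idempotents (SS' n) - {Map.empty})"
  (is "?I' = ?I \<union> ?fixed ` ?I \<union> ?moved ` (?I - {Map.empty})")
proof (intro equalityI subsetI)
  fix \<alpha> assume \<alpha>: "\<alpha> \<in> ?I'"
  define \<beta> where "\<beta> = \<alpha>(Suc n := None)"
  have dom: "dom \<alpha> \<subseteq> {2..Suc n}"
    and idem: "\<And>x y. \<alpha> x = Some y \<Longrightarrow> y \<le> x \<and> \<alpha> y = Some y"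
    and mono: "\<And>x y u v. \<alpha> x = Some u \<Longrightarrow> \<alpha> y = Some v \<Longrightarrow> x \<le> y \<Longrightarrow> u \<le> v"
    using \<alpha> unfolding idempotents_SS'_iff by blast+
  have le: "x \<le> Suc n" if "\<alpha> x = Some y" for x y
    using domI[of \<alpha> x y] dom that by auto
  have dom\<beta>: "dom \<beta> \<subseteq> {2..n}"
    using dom unfolding \<beta>_def dom_fun_upd by (auto simp: atLeastAtMostSuc_conv)
  \<comment> \<open>The removed point cannot be the image of another one: y = n + 1 would force x =
    n + 1 by y \<le> x, but \<beta> is undefined there.\<close>
  have fix\<beta>: "y \<le> x \<and> \<beta> y = Some y" if "\<beta> x = Some y" for x y
    using that idem[of x y] le[of x y] by (auto simp: \<beta>_def split: if_splits)
  have mono\<beta>: "u \<le> v" if "\<beta> x = Some u" "\<beta> y = Some v" "x \<le> y" for x y u v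
    using that mono[of x u y v] by (auto simp: \<beta>_def split: if_splits)
  have \<beta>: "\<beta> \<in> ?I"
    unfolding idempotents_SS'_iff using dom\<beta> fix\<beta> mono\<beta> by blast
  show "\<alpha> \<in> ?I \<union> ?fixed ` ?I \<union> ?moved ` (?I - {Map.empty})"
  proof (cases "\<alpha> (Suc n)")
    case None
    then have "\<alpha> = \<beta>" by (auto simp: \<beta>_def)
    then show ?thesis using \<beta> by simp
  next
    case (Some y)
    then have \<alpha>_eq: "\<alpha> = \<beta>(Suc n \<mapsto> y)" by (auto simp: \<beta>_def)
    show ?thesis
    proof (cases "y = Suc n")
      case True
      then show ?thesis using \<beta> \<alpha>_eq by blast
    next
      case False
      then have y: "\<beta> y = Some y" using idem[OF Some] by (simp add: \<beta>_def)
      \<comment> \<open>Since n + 1 lies above the whole domain, isotonicity makes its image y an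
        upper bound of all images; y is itself an image under \<beta>, being a fixed point.\<close>
      have "v \<le> y" if v: "v \<in> ran \<beta>" for v
      proof -
        obtain x where "\<alpha> x = Some v" using v by (auto simp: ran_def \<beta>_def split: if_splits)
        then show ?thesis using mono[OF _ Some] le by blast
      qed
      moreover have "y \<in> ran \<beta>" using y by (rule ranI)
      moreover have "finite (ran \<beta>)" using \<beta> by (rule ran_idempotents_SS'(2))
      ultimately have "Max (ran \<beta>) = y" by (intro Max_eqI)
      then have "\<alpha> = ?moved \<beta>" using \<alpha>_eq by simp
      moreover have "\<beta> \<noteq> Map.empty" using y by auto
      ultimately show ?thesis using \<beta> by blast
    qed
  qed
next
  fix \<alpha> assume "\<alpha> \<in> ?I \<union> ?fixed ` ?I \<union> ?moved ` (?I - {Map.empty})"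
  then consider "\<alpha> \<in> ?I" | \<beta> where "\<beta> \<in> ?I" "\<alpha> = ?fixed \<beta>"
    | \<beta> where "\<beta> \<in> ?I" "\<beta> \<noteq> Map.empty" "\<alpha> = ?moved \<beta>"
    by blast
  then show "\<alpha> \<in> ?I'"
  proof cases
    case 1
    then show ?thesis by (force simp: idempotents_SS'_iff)
  next
    case (2 \<beta>)
    have "v \<le> Suc n" if "v \<in> ran \<beta>" for v
      using ran_idempotents_SS'(1)[OF 2(1)] that by auto
    then show ?thesis using 2 assms by (auto intro!: idempotents_SS'_upd)
  next
    case (3 \<beta>)
    have idem: "\<beta> x = Some y \<Longrightarrow> \<beta> y = Some y" for x y
      using 3(1) unfolding idempotents_SS'_iff by blast
    have "Max (ran \<beta>) \<in> ran \<beta>" by (rule ran_idempotents_SS'(3)[OF 3(1,2)])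
    then have "\<beta> (Max (ran \<beta>)) = Some (Max (ran \<beta>))" using idem unfolding ran_def by blast
    \<comment> \<open>No case distinction is needed: if the argument were the updated point, the
      update would give the same value.\<close>
    then have "(?moved \<beta>) (Max (ran \<beta>)) = Some (Max (ran \<beta>))" by simp
    then show ?thesis unfolding 3(3)
      by (intro idempotents_SS'_upd 3(1) assms Max_ge ran_idempotents_SS'(2)[OF 3(1)])
  qed
qed

text \<open>Counting from \<open>Suc m\<close> lets the induction start at the one-point chain, and
  doubling avoids division. Finiteness is carried along for the cardinalities of the disjoint
  unions.\<close>

lemma card_idempotents_SS':
  "finite (idempotents (SS' (Suc m))) \<and> 2 * card (idempotents (SS' (Suc m))) = 3 ^ m + 1"
proof (induction m)
  case 0
  then show ?case by (simp add: idempotents_SS'_1)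
next
  case (Suc m)
  let ?k = "Suc (Suc m)"
  let ?I = "idempotents (SS' (Suc m))"
  let ?fixed = "\<lambda>\<alpha>. \<alpha>(?k \<mapsto> ?k)" and ?moved = "\<lambda>\<alpha>. \<alpha>(?k \<mapsto> Max (ran \<alpha>))"
  have fin: "finite ?I" using Suc by simp
  have dom: "dom \<alpha> \<subseteq> {2..Suc m}" if "\<alpha> \<in> ?I" for \<alpha>
    using that by (simp add: idempotents_SS'_iff)
  have none: "\<alpha> ?k = None" if "\<alpha> \<in> ?I" for \<alpha>
    using dom[OF that] by force
  \<comment> \<open>Members of \<open>?I\<close> are undefined at \<open>?k\<close>, so erasing the
    value there recovers \<alpha>, whatever \<open>f\<close> is; this covers both extension
    maps.\<close>
  have inj: "inj_on (\<lambda>\<alpha>. \<alpha>(?k \<mapsto> f \<alpha>)) ?I" for f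
    by (intro inj_onI) (metis fun_upd_triv fun_upd_upd none)
  \<comment> \<open>The three pieces are told apart by the value at \<open>?k\<close>: undefined,
    equal to \<open>?k\<close>, or an image point of a map in \<open>?I\<close>, which is at most
    \<open>Suc m\<close>.\<close>
  have Max: "Max (ran \<alpha>) \<noteq> ?k" if "\<alpha> \<in> ?I - {Map.empty}" for \<alpha>
    using ran_idempotents_SS'(1,3)[of \<alpha> "Suc m"] that by force
  have disj1: "?I \<inter> ?fixed ` ?I = {}"
    by (auto dest: none)
  have disj2: "(?I \<union> ?fixed ` ?I) \<inter> ?moved ` (?I - {Map.empty}) = {}"
  proof (rule Int_emptyI)
    fix \<alpha> assume \<alpha>: "\<alpha> \<in> ?I \<union> ?fixed ` ?I" "\<alpha> \<in> ?moved ` (?I - {Map.empty})"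
    from \<alpha>(2) obtain \<beta> where "\<alpha> = ?moved \<beta>" and \<beta>: "\<beta> \<in> ?I - {Map.empty}"
      by (rule imageE)
    moreover have "\<alpha> ?k \<in> {None, Some ?k}" using \<alpha>(1) none by fastforce
    ultimately show False using Max[OF \<beta>] by simp
  qed
  \<comment> \<open>Removing the empty map loses exactly one element, and
    \<open>card ?I \<ge> 1\<close> makes the truncated subtraction exact. The recurrence then gives
    3 * (3 ^ m + 1) - 2 = 3 ^ (m + 1) + 1 for the doubled count.\<close>
  have "Map.empty \<in> ?I" by (simp add: idempotents_SS'_iff)
  then have "card ?I \<ge> 1" "card (?I - {Map.empty}) = card ?I - 1"
    using fin by (auto simp: card_gt_0_iff Suc_le_eq)
  moreover have "card (?fixed ` ?I) = card ?I"
    by (intro card_image inj)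
  moreover have "card (?moved ` (?I - {Map.empty})) = card (?I - {Map.empty})"
    by (intro card_image inj_on_subset[OF inj]) blast
  moreover have "idempotents (SS' ?k) = ?I \<union> ?fixed ` ?I \<union> ?moved ` (?I - {Map.empty})"
    by (rule idempotents_SS'_Suc) simp
  ultimately show ?case
    using Suc fin by (simp add: card_Un_disjoint disj1 disj2)
qed

theorem theorem2p20:
  fixes n :: nat
  assumes "n \<ge> 2"
  shows "real (card (idempotents (SS' n))) = (3 ^ (n - 1) + 1) / 2"
proof -
  have "2 * card (idempotents (SS' n)) = 3 ^ (n - 1) + 1"
    using card_idempotents_SS'[of "n - 1"] assms by simp
  then have "real (2 * card (idempotents (SS' n))) = real (3 ^ (n - 1) + 1)"
    by (rule arg_cong)
  then show ?thesis by simp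
qed

end
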